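(* Let $X$ be a compact metric space and let $S,T:X\to X$ be continuous and onto maps with $ST=TS$ and $T$ transitive. Let $\mathcal{F}$ be a family of $S$-subsystems of $X$ which is closed under taking subsystems (i.e. if $Y\in\mathcal{F}$ and $Z$ is an $S$-subsystem of $X$ with $Z\subseteq Y$, then $Z\in\mathcal{F}$). Assume further that every non-empty closed set $Z\subseteq X$ with $SZ\subseteq Z$ and $TZ\subseteq Z$ is either an element of $\mathcal{F}$ or equal to $X$. Then every minimal $S$-subsystem $Y\subseteq X$ that does not belong to $\mathcal{F}$ contains a dense $G_\delta$ subset (relative to $Y$) consisting of $T$-transitive points, i.e. points $y$ for which $\{T^ny\}_{n\geq 0}$ is dense in $X$.
   Context: For a continuous map $S:X\to X$ of a metric space, an $S$-subsystem is a closed set $Y\subseteq X$ with $SY\subseteq Y$. The map $T$ is transitive if there is $x\in X$ with $\{T^nx\}_{n\geq0}$ dense in $X$. An $S$-subsystem $Y$ is minimal if it is non-empty and for every $y\in Y$ the orbit $\{S^ny\}_{n\geq 0}$ is dense in $Y$. *)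

theory Defs
  imports "HOL-Analysis.Analysis"
begin

text \<open>The phase space is a carrier set \<open>X\<close> in an ambient metric space, with the subspace topology
  \<open>top_of_set X\<close>; maps are only constrained on \<open>X\<close>.\<close>

definition orbit_of :: "('a \<Rightarrow> 'a) \<Rightarrow> 'a \<Rightarrow> 'a set" where
  "orbit_of S x = {(S ^^ n) x |n. True}"

definition dense_subset :: "'a::topological_space set \<Rightarrow> 'a set \<Rightarrow> bool" where
  "dense_subset D Y \<longleftrightarrow> D \<subseteq> Y \<and> top_of_set Y closure_of D = Y"

definition subsystem :: "'a::metric_space set \<Rightarrow> ('a \<Rightarrow> 'a) \<Rightarrow> 'a set \<Rightarrow> bool" where
  "subsystem X S Y \<longleftrightarrow> closedin (top_of_set X) Y \<and> S ` Y \<subseteq> Y"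

definition minimal_subsystem :: "'a::metric_space set \<Rightarrow> ('a \<Rightarrow> 'a) \<Rightarrow> 'a set \<Rightarrow> bool" where
  "minimal_subsystem X S Y \<longleftrightarrow>
     subsystem X S Y \<and> Y \<noteq> {} \<and> (\<forall>y\<in>Y. dense_subset (orbit_of S y) Y)"

definition transitive_point :: "'a::metric_space set \<Rightarrow> ('a \<Rightarrow> 'a) \<Rightarrow> 'a \<Rightarrow> bool" where
  "transitive_point X T x \<longleftrightarrow> x \<in> X \<and> dense_subset (orbit_of T x) X"

definition transitive_map :: "'a::metric_space set \<Rightarrow> ('a \<Rightarrow> 'a) \<Rightarrow> bool" where
  "transitive_map X T \<longleftrightarrow> (\<exists>x. transitive_point X T x)"

end

theory Submission
  imports Defs
begin

text \<open>Fix a transitive point \<open>x\<close>. A point is transitive as soon as its \<open>T\<close>-orbit accumulates at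
  \<open>x\<close>, so the transitive points in \<open>Y\<close> are the intersection of the relatively open sets of points
  whose orbit meets the ball of radius \<open>1/(k+1)\<close> about \<open>x\<close>; by Baire it suffices that these are
  dense in \<open>Y\<close>. If a non-empty relatively open \<open>V \<subseteq> Y\<close> misses one of them, it lies in the proper closed
  \<open>T\<close>-invariant set \<open>B\<close> of points whose orbit avoids the ball. By minimality \<open>Y\<close>
  is covered by finitely many \<open>S\<^sup>-\<^sup>i V\<close>, and since \<open>Y \<notin> F\<close> the sets \<open>T\<^sup>n Y\<close> have dense
  union, so \<open>X\<close> is a finite union of the closed \<open>T\<close>-invariant sets \<open>S\<^sup>-\<^sup>i B\<close>. The one
  containing \<open>x\<close> is all of \<open>X\<close>, and \<open>S\<close> being onto gives \<open>B = X\<close>, which is absurd.\<close>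

section \<open>Iterates of a map on an invariant set\<close>

lemma funpow_mem:
  assumes "f ` X \<subseteq> X" "x \<in> X"
  shows "(f ^^ n) x \<in> X"
  using assms by (induction n) auto

lemma funpow_image_eq:
  assumes "f ` X = X"
  shows "(f ^^ n) ` X = X"
proof (induction n)
  case (Suc n)
  have "(f ^^ Suc n) ` X = f ` ((f ^^ n) ` X)"
    by (simp add: image_comp)
  then show ?case
    using Suc assms by simp
qed simp

lemma continuous_on_funpow:
  assumes "continuous_on X f" "f ` X \<subseteq> X"
  shows "continuous_on X (f ^^ n)"
proof (induction n)
  case (Suc n)
  have "(f ^^ n) ` X \<subseteq> X"
    using funpow_mem [OF assms(2)] by blast
  then have "continuous_on X (f \<circ> (f ^^ n))"
    by (intro continuous_on_compose Suc continuous_on_subset [OF assms(1)])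
  then show ?case
    by simp
qed simp

lemma funpow_commute_on:
  assumes "f ` X \<subseteq> X" "\<forall>x\<in>X. f (g x) = g (f x)" "x \<in> X"
  shows "(f ^^ n) (g x) = g ((f ^^ n) x)"
  using funpow_mem [OF assms(1,3)] assms(2) by (induction n) auto

section \<open>Orbits and closed invariant sets\<close>

lemma image_orbit_subset: "f ` orbit_of f x \<subseteq> orbit_of f x"
proof -
  have "f ((f ^^ n) x) \<in> orbit_of f x" for n
    unfolding orbit_of_def by (rule CollectI, rule exI [of _ "Suc n"]) simp
  then show ?thesis
    by (auto simp: orbit_of_def)
qed

lemma orbit_subset:
  assumes "f ` C \<subseteq> C" "x \<in> C"
  shows "orbit_of f x \<subseteq> C"
  using funpow_mem [OF assms] by (auto simp: orbit_of_def)

lemma closure_of_image_subset: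
  assumes "continuous_on X f" "f ` X \<subseteq> X" "f ` A \<subseteq> A"
  shows "f ` (top_of_set X closure_of A) \<subseteq> top_of_set X closure_of A"
proof -
  have "continuous_map (top_of_set X) (top_of_set X) f"
    using assms(1,2) by auto
  then have "f ` (top_of_set X closure_of A) \<subseteq> top_of_set X closure_of (f ` A)"
    by (rule continuous_map_image_closure_subset)
  also have "\<dots> \<subseteq> top_of_set X closure_of A"
    by (rule closure_of_mono) fact
  finally show ?thesis .
qed

text \<open>A closed invariant set containing \<open>x\<close> contains the closure of the orbit of
  \<open>x\<close>, which is all of \<open>X\<close>.\<close>

lemma closed_invariant_eq_if_transitive_point:
  assumes "transitive_point X T x" "closedin (top_of_set X) C" "T ` C \<subseteq> C" "x \<in> C"
  shows "C = X"
proof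
  have "top_of_set X closure_of (orbit_of T x) \<subseteq> C"
    using assms orbit_subset by (intro closure_of_minimal)
  then show "X \<subseteq> C"
    using assms(1) by (simp add: transitive_point_def dense_subset_def)
  show "C \<subseteq> X"
    using closedin_subset [OF assms(2)] by simp
qed

text \<open>The orbit closure of \<open>y\<close> is itself closed and invariant, so the preceding
  lemma applies to it. This reduces transitivity of \<open>y\<close> to approximating the single
  point \<open>x\<close>, for which countably many balls suffice.\<close>

lemma transitive_point_if_closure_orbit:
  assumes "continuous_on X T" "T ` X \<subseteq> X" "transitive_point X T x" "y \<in> X"
    and "x \<in> top_of_set X closure_of (orbit_of T y)"
  shows "transitive_point X T y"
proof -
  have "top_of_set X closure_of (orbit_of T y) = X"
    using closed_invariant_eq_if_transitive_point [OF assms(3) closedin_closure_of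
      closure_of_image_subset [OF assms(1,2) image_orbit_subset] assms(5)] .
  then show ?thesis
    using assms(4) orbit_subset [OF assms(2,4)]
    by (simp add: transitive_point_def dense_subset_def)
qed

section \<open>The Baire category argument in \<open>Y\<close>\<close>

lemma transitive_points_dense_gdelta:
  assumes "compact X" "continuous_on X T" "T ` X \<subseteq> X" "transitive_point X T x"
    and "closedin (top_of_set X) Y"
    and meet: "\<And>U V. \<lbrakk>open U; x \<in> U; openin (top_of_set Y) V; V \<noteq> {}\<rbrakk> \<Longrightarrow>
      \<exists>y\<in>V. \<exists>n. (T ^^ n) y \<in> U"
  shows "\<exists>G. gdelta_in (top_of_set Y) G \<and> dense_subset G Y \<and> (\<forall>y\<in>G. transitive_point X T y)"
proof -
  have "Y \<subseteq> X" "compact Y"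
    using closedin_imp_subset [OF assms(5)] closedin_compact [OF assms(1,5)] by auto
  define W where "W k = (\<Union>n. Y \<inter> (T ^^ n) -` ball x (1 / Suc k))" for k
  define G where "G = (\<Inter>k. W k)"
  have W_open: "openin (top_of_set Y) (W k)" for k
  proof -
    have "continuous_on Y (T ^^ n)" for n
      using continuous_on_funpow [OF assms(2,3)] \<open>Y \<subseteq> X\<close> continuous_on_subset by blast
    then show ?thesis
      unfolding W_def by (intro openin_Union ballI) (auto intro: continuous_openin_preimage_gen)
  qed
  have W_dense: "top_of_set Y closure_of W k = topspace (top_of_set Y)" for k
    unfolding dense_intersects_open
  proof (intro allI impI)
    fix V assume V: "openin (top_of_set Y) V \<and> V \<noteq> {}"
    then obtain y n where "y \<in> V" "(T ^^ n) y \<in> ball x (1 / Suc k)"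
      using meet [of "ball x (1 / Suc k)" V] by auto
    moreover have "V \<subseteq> Y"
      using V openin_imp_subset by blast
    ultimately show "W k \<inter> V \<noteq> {}"
      unfolding W_def by blast
  qed
  \<comment> \<open>Baire is applied to the space \<open>Y\<close> itself, in its version for
    locally compact regular spaces.\<close>
  have "locally_compact_space (top_of_set Y)"
    using \<open>compact Y\<close> by (simp add: compact_imp_locally_compact_space compact_space_subtopology)
  moreover have "regular_space (top_of_set Y)"
    by (simp add: regular_space_euclidean regular_space_subtopology)
  ultimately have "top_of_set Y closure_of G = topspace (top_of_set Y)"
    unfolding G_def using W_open W_dense by (intro Baire_category) auto
  moreover have "G \<subseteq> Y"
    unfolding G_def W_def by blast
  ultimately have "dense_subset G Y"
    by (simp add: dense_subset_def)
  moreover have "gdelta_in (top_of_set Y) G"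
    unfolding G_def using W_open by (intro gdelta_in_Inter) (auto intro: open_imp_gdelta_in)
  moreover have "transitive_point X T y" if "y \<in> G" for y
  proof -
    have "y \<in> X"
      using that \<open>G \<subseteq> Y\<close> \<open>Y \<subseteq> X\<close> by blast
    have "x \<in> X"
      using assms(4) by (simp add: transitive_point_def)
    have "\<exists>z\<in>orbit_of T y. dist z x < e" if "e > 0" for e
    proof -
      obtain k where k: "1 / Suc k < e"
        using nat_approx_posE \<open>e > 0\<close> by metis
      obtain n where "dist x ((T ^^ n) y) < 1 / Suc k"
        using \<open>y \<in> G\<close> unfolding G_def W_def by auto
      with k show ?thesis
        unfolding orbit_of_def by (auto simp: dist_commute intro!: exI [of _ n])
    qed
    then have "x \<in> closure (orbit_of T y)"
      by (simp add: closure_approachable)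
    \<comment> \<open>The orbit of \<open>y\<close> stays in \<open>X\<close>, so the relative
      closure is the ambient closure cut down to \<open>X\<close>.\<close>
    then have "x \<in> top_of_set X closure_of (orbit_of T y)"
      using \<open>x \<in> X\<close> orbit_subset [OF assms(3) \<open>y \<in> X\<close>]
      by (simp add: closure_of_subtopology inf.absorb2)
    then show ?thesis
      by (rule transitive_point_if_closure_orbit [OF assms(2-4) \<open>y \<in> X\<close>])
  qed
  ultimately show ?thesis
    by blast
qed

section \<open>Minimality and the density of the open sets in \<open>Y\<close>\<close>

lemma minimal_subsystem_finite_cover:
  assumes "compact X" "continuous_on X S" "minimal_subsystem X S Y"
    and "openin (top_of_set Y) V" "V \<noteq> {}"
  obtains I where "finite I" "\<And>y. y \<in> Y \<Longrightarrow> \<exists>i\<in>I. (S ^^ i) y \<in> V"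
proof -
  have Y: "closedin (top_of_set X) Y" "S ` Y \<subseteq> Y"
    and orbit: "\<And>y. y \<in> Y \<Longrightarrow> top_of_set Y closure_of orbit_of S y = topspace (top_of_set Y)"
    using assms(3) by (auto simp: minimal_subsystem_def subsystem_def dense_subset_def)
  have "Y \<subseteq> X" "compact Y"
    using closedin_imp_subset [OF Y(1)] closedin_compact [OF assms(1) Y(1)] by auto
  \<comment> \<open>The orbit of every point of \<open>Y\<close> is dense in \<open>Y\<close> and so
    enters \<open>V\<close>; hence these sets cover \<open>Y\<close>, and compactness makes one
    finite set of times serve all points at once.\<close>
  define C where "C i = Y \<inter> (S ^^ i) -` V" for i
  have "continuous_on Y S"
    using assms(2) \<open>Y \<subseteq> X\<close> continuous_on_subset by blast
  \<comment> \<open>As \<open>V\<close> is only relatively open, the iterates must be read as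
    self-maps of \<open>Y\<close>.\<close>
  then have C_open: "openin (top_of_set Y) (C i)" for i
    unfolding C_def using continuous_on_funpow funpow_mem [OF Y(2)] Y(2) assms(4)
    by (intro continuous_openin_preimage [where T = Y]) auto
  have C_cover: "Y \<subseteq> (\<Union>i. C i)"
  proof
    fix y assume "y \<in> Y"
    then have "orbit_of S y \<inter> V \<noteq> {}"
      using orbit assms(4,5) dense_intersects_open by metis
    then show "y \<in> (\<Union>i. C i)"
      using \<open>y \<in> Y\<close> unfolding C_def orbit_of_def by auto
  qed
  obtain \<D> where "\<D> \<subseteq> range C" "finite \<D>" "Y \<subseteq> \<Union>\<D>"
    using \<open>compact Y\<close> [unfolded compact_eq_openin_cover, rule_format, of "range C"]
      C_open C_cover by auto
  then obtain I where "finite I" "\<D> = C ` I"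
    by (metis finite_subset_image)
  with \<open>Y \<subseteq> \<Union>\<D>\<close> have "\<exists>i\<in>I. (S ^^ i) y \<in> V" if "y \<in> Y" for y
    using that unfolding C_def by blast
  with \<open>finite I\<close> show thesis
    by (rule that)
qed

text \<open>The premise \<open>dense\<close> isolates what the family \<open>F\<close> contributes:
  it expresses that the forward \<open>T\<close>-images of \<open>Y\<close> have dense union in
  \<open>X\<close>.\<close>

lemma minimal_open_meets_transitive_neighbourhood:
  assumes "compact X" "continuous_on X S" "S ` X = X" "continuous_on X T" "T ` X \<subseteq> X"
    and comm: "\<forall>x\<in>X. S (T x) = T (S x)"
    and "transitive_point X T x" "minimal_subsystem X S Y"
    and dense: "\<And>C. \<lbrakk>closedin (top_of_set X) C; T ` C \<subseteq> C; Y \<subseteq> C\<rbrakk> \<Longrightarrow> C = X"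
    and "open U" "x \<in> U" "openin (top_of_set Y) V" "V \<noteq> {}"
  shows "\<exists>y\<in>V. \<exists>n. (T ^^ n) y \<in> U"
proof (rule ccontr)
  assume V_avoids: "\<not> ?thesis"
  have "S ` X \<subseteq> X" "x \<in> X"
    using assms by (auto simp: transitive_point_def)
  have "Y \<subseteq> X"
    using assms(8) by (auto simp: minimal_subsystem_def subsystem_def dest: closedin_imp_subset)
  have "V \<subseteq> Y"
    using openin_imp_subset [OF assms(12)] .
  define B where "B = (\<Inter>n. X \<inter> (T ^^ n) -` (- U))"
  have B_closed: "closedin (top_of_set X) B"
    unfolding B_def using \<open>open U\<close> continuous_on_funpow [OF assms(4,5)]
    by (intro closedin_Inter) (auto intro!: continuous_closedin_preimage)
  have B_inv: "T ` B \<subseteq> B"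
  proof
    fix w assume "w \<in> T ` B"
    then obtain z where z: "w = T z" "z \<in> B"
      by blast
    \<comment> \<open>The orbit of \<open>T z\<close> is a tail of the orbit of \<open>z\<close>, so
      it avoids \<open>U\<close> as well.\<close>
    have "(T ^^ Suc n) z \<notin> U" for n
      using z(2) unfolding B_def by blast
    then show "w \<in> B"
      using z assms(5) unfolding B_def by (auto simp: funpow_swap1)
  qed
  have "V \<subseteq> B"
    using V_avoids \<open>V \<subseteq> Y\<close> \<open>Y \<subseteq> X\<close> unfolding B_def by auto
  \<comment> \<open>Pulling \<open>B\<close> back along \<open>S ^^ i\<close> preserves
    \<open>T\<close>-invariance because the iterate commutes with \<open>T\<close>.\<close>
  define P where "P i = X \<inter> (S ^^ i) -` B" for i
  have P_closed: "closedin (top_of_set X) (P i)" for i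
    unfolding P_def
    using continuous_on_funpow [OF assms(2) \<open>S ` X \<subseteq> X\<close>] funpow_mem [OF \<open>S ` X \<subseteq> X\<close>] B_closed
    by (intro continuous_closedin_preimage_gen [where T = X]) auto
  have P_inv: "T ` P i \<subseteq> P i" for i
    using assms(5) B_inv funpow_commute_on [OF \<open>S ` X \<subseteq> X\<close> comm] unfolding P_def by fastforce
  obtain I where "finite I" and I: "\<And>y. y \<in> Y \<Longrightarrow> \<exists>i\<in>I. (S ^^ i) y \<in> V"
    using minimal_subsystem_finite_cover [OF assms(1,2,8,12,13)] by blast
  have "(\<Union>i\<in>I. P i) = X"
  proof (rule dense)
    \<comment> \<open>Finiteness of \<open>I\<close> is what keeps the union closed.\<close>
    show "closedin (top_of_set X) (\<Union>i\<in>I. P i)"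
      using \<open>finite I\<close> P_closed by (intro closedin_Union) auto
    show "T ` (\<Union>i\<in>I. P i) \<subseteq> (\<Union>i\<in>I. P i)"
      using P_inv by blast
    show "Y \<subseteq> (\<Union>i\<in>I. P i)"
    proof
      fix y assume "y \<in> Y"
      then obtain i where "i \<in> I" "(S ^^ i) y \<in> V"
        using I by blast
      with \<open>y \<in> Y\<close> show "y \<in> (\<Union>i\<in>I. P i)"
        using \<open>V \<subseteq> B\<close> \<open>Y \<subseteq> X\<close> unfolding P_def by auto
    qed
  qed
  then obtain i where "x \<in> P i"
    using \<open>x \<in> X\<close> by blast
  then have "P i = X"
    using closed_invariant_eq_if_transitive_point [OF assms(7) P_closed P_inv] by simp
  then have "(S ^^ i) ` X \<subseteq> B"
    unfolding P_def by blast
  then have "X \<subseteq> B"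
    by (simp add: funpow_image_eq [OF assms(3)])
  \<comment> \<open>Time 0 counts in the definition of \<open>B\<close>, so \<open>B\<close> is
    disjoint from \<open>U\<close>, whereas \<open>x\<close> lies in \<open>U\<close>.\<close>
  then have "(T ^^ 0) x \<notin> U"
    using \<open>x \<in> X\<close> unfolding B_def by blast
  with \<open>x \<in> U\<close> show False
    by simp
qed

text \<open>The closure \<open>K\<close> of the union of all \<open>T\<close>-orbits from
  \<open>Y\<close> is invariant under both maps, hence in \<open>F\<close> or equal to
  \<open>X\<close>. Any closed \<open>T\<close>-invariant set containing \<open>Y\<close> contains
  \<open>K\<close>.\<close>

lemma closed_invariant_superset_eq:
  assumes "continuous_on X S" "S ` X \<subseteq> X" "continuous_on X T" "T ` X \<subseteq> X"
    and comm: "\<forall>x\<in>X. S (T x) = T (S x)"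
    and her: "\<forall>Y Z. Y \<in> F \<and> subsystem X S Z \<and> Z \<subseteq> Y \<longrightarrow> Z \<in> F"
    and inv: "\<forall>Z. Z \<noteq> {} \<and> closedin (top_of_set X) Z \<and> S ` Z \<subseteq> Z \<and> T ` Z \<subseteq> Z \<longrightarrow> Z \<in> F \<or> Z = X"
    and Y: "subsystem X S Y" "Y \<noteq> {}" "Y \<notin> F"
    and C: "closedin (top_of_set X) C" "T ` C \<subseteq> C" "Y \<subseteq> C"
  shows "C = X"
proof -
  have "Y \<subseteq> X" "S ` Y \<subseteq> Y"
    using Y(1) by (auto simp: subsystem_def dest: closedin_imp_subset)
  define A where "A = (\<Union>y\<in>Y. orbit_of T y)"
  define K where "K = top_of_set X closure_of A"
  have "A \<subseteq> X"
    using orbit_subset [OF assms(4)] \<open>Y \<subseteq> X\<close> unfolding A_def by blast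
  have "y \<in> orbit_of T y" for y
    unfolding orbit_of_def by (rule CollectI, rule exI [of _ 0]) simp
  then have "Y \<subseteq> A"
    unfolding A_def by blast
  then have "Y \<subseteq> K"
    unfolding K_def using \<open>A \<subseteq> X\<close> closure_of_subset [of A "top_of_set X"] by simp
  have "T ` A \<subseteq> A"
    unfolding A_def image_UN using image_orbit_subset by (rule UN_mono [OF order_refl])
  have "S ` A \<subseteq> A"
  proof
    fix w assume "w \<in> S ` A"
    then obtain y n where y: "y \<in> Y" "w = S ((T ^^ n) y)"
      unfolding A_def orbit_of_def by blast
    \<comment> \<open>Commuting \<open>S\<close> past the iterate moves it onto the starting point,
      which stays in \<open>Y\<close>.\<close>
    then have "w = (T ^^ n) (S y)"
      using funpow_commute_on [OF assms(4), of S y n] comm \<open>Y \<subseteq> X\<close> by auto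
    then have "w \<in> orbit_of T (S y)"
      unfolding orbit_of_def by blast
    moreover have "S y \<in> Y"
      using y(1) \<open>S ` Y \<subseteq> Y\<close> by blast
    ultimately show "w \<in> A"
      unfolding A_def by blast
  qed
  have "K \<in> F \<or> K = X"
  proof (rule inv [rule_format], intro conjI)
    show "K \<noteq> {}"
      using \<open>Y \<subseteq> K\<close> Y(2) by blast
    show "closedin (top_of_set X) K"
      unfolding K_def by (rule closedin_closure_of)
    show "S ` K \<subseteq> K" "T ` K \<subseteq> K"
      unfolding K_def
      using closure_of_image_subset [OF assms(1,2) \<open>S ` A \<subseteq> A\<close>]
        closure_of_image_subset [OF assms(3,4) \<open>T ` A \<subseteq> A\<close>] .
  qed
  \<comment> \<open>If \<open>K\<close> were in \<open>F\<close>, heredity would put its subsystem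
    \<open>Y\<close> in \<open>F\<close>.\<close>
  moreover have "K \<notin> F"
    using her [rule_format, of K Y] Y(1,3) \<open>Y \<subseteq> K\<close> by blast
  ultimately have "K = X"
    by blast
  moreover have "K \<subseteq> C"
    unfolding K_def A_def using orbit_subset [OF C(2)] C(1,3)
    by (intro closure_of_minimal) auto
  ultimately show ?thesis
    using closedin_subset [OF C(1)] by auto
qed

theorem proposition1p6:
  fixes X :: "'a::metric_space set"
    and S T :: "'a \<Rightarrow> 'a"
    and F :: "'a set set"
  assumes "compact X"
    and "continuous_on X S" and "S ` X = X"
    and "continuous_on X T" and "T ` X = X"
    and "\<forall>x\<in>X. S (T x) = T (S x)"
    and "transitive_map X T"
    and "\<forall>Y\<in>F. subsystem X S Y"
    and "\<forall>Y Z. Y \<in> F \<and> subsystem X S Z \<and> Z \<subseteq> Y \<longrightarrow> Z \<in> F"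
    and "\<forall>Z. Z \<noteq> {} \<and> closedin (top_of_set X) Z \<and> S ` Z \<subseteq> Z \<and> T ` Z \<subseteq> Z \<longrightarrow> Z \<in> F \<or> Z = X"
  shows "\<forall>Y. minimal_subsystem X S Y \<and> Y \<notin> F \<longrightarrow>
    (\<exists>G. gdelta_in (top_of_set Y) G \<and> dense_subset G Y \<and> (\<forall>y\<in>G. transitive_point X T y))"
proof (intro allI impI)
  fix Y assume "minimal_subsystem X S Y \<and> Y \<notin> F"
  then have Y: "minimal_subsystem X S Y" "subsystem X S Y" "Y \<noteq> {}" "Y \<notin> F"
    by (auto simp: minimal_subsystem_def)
  obtain x where x: "transitive_point X T x"
    using assms(7) by (auto simp: transitive_map_def)
  have sub: "S ` X \<subseteq> X" "T ` X \<subseteq> X"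
    using assms(3,5) by auto
  show "\<exists>G. gdelta_in (top_of_set Y) G \<and> dense_subset G Y \<and> (\<forall>y\<in>G. transitive_point X T y)"
  proof (rule transitive_points_dense_gdelta [OF assms(1,4) sub(2) x])
    show "closedin (top_of_set X) Y"
      using Y(2) by (simp add: subsystem_def)
    show "\<exists>y\<in>V. \<exists>n. (T ^^ n) y \<in> U"
      if "open U" "x \<in> U" "openin (top_of_set Y) V" "V \<noteq> {}" for U V
      using closed_invariant_superset_eq [OF assms(2) sub(1) assms(4) sub(2) assms(6,9,10) Y(2-4)]
      by (rule minimal_open_meets_transitive_neighbourhood
        [OF assms(1-4) sub(2) assms(6) x Y(1) _ that])
  qed
qed

end
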